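(* Consider the Locks, Bombs and Testing game with $n=2$ sites of values $c\ge 1$ (site 1) and $1$ (site 2), one lock, one bomb, explosion probability $1$, and test sensitivity $a$ and specificity $b$ (the same for both sites) with $1/2<a,b<1$, as described in the context. Let $x\in[0,1]$ be the prior probability that the lock is in site 2 (so $1-x$ is the probability that it is in site 1), and let $d(x)$ be the expected damage when the attacker responds optimally to $x$. Put $$e_1=ab,\quad e_2=(1-a)(1-b),\quad \kappa=\frac{e_1}{e_2}=\frac{ab}{(1-a)(1-b)},\quad c_*=\frac{a+b}{ab}-1,\quad \rho_1=\frac{1}{1+c\kappa},\quad \rho_3=\frac1{1+c}.$$ Then $c_*>1$, and the minimum $v_*=\min_{0\le x\le 1}d(x)$ (the value of the game) and an optimal strategy $x_*$ of the defender (a point where the minimum is attained) are as follows: (i) if $1\le c\le c_*$, then $x_*=\rho_3=\dfrac{1}{1+c}$ and $v_*=d(\rho_3)=\dfrac{c(a+b)}{1+c}$; (ii) if $c\ge c_*$, then $x_*=\rho_1=\dfrac{1}{1+c\kappa}$ and $v_*=d(\rho_1)=\dfrac{c}{1/\kappa+c}$; (iii) if $c=c_*$, then the minimum of $d$ is attained at every point of the interval $(\rho_1,\rho_3)$, and $v_*=d(\rho_1)=d(\rho_3)=a+b-ab$.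
   Context: **Game.** The defender places one lock in one of two sites; the lock is in site 2 with probability $x$ and in site 1 with probability $1-x$. The number $x$ is the defender's strategy and is known to the attacker; the actual position of the lock is not. Let $T_i=1$ if site $i$ has the lock and $T_i=0$ otherwise. Each site is tested, producing a signal $s=(s_1,s_2)\in\{0,1\}^2$. Given the lock position, the two test results $S_1,S_2$ are independent, $S_i$ depends only on $T_i$, and $P(S_i=1\mid T_i=1)=a$ (sensitivity), $P(S_i=0\mid T_i=0)=b$ (specificity). The attacker sees $s$ and then places one bomb in one of the two sites. The bomb destroys the site if and only if the site has no lock; the damage is the value of the destroyed site ($c$ for site 1, $1$ for site 2), or $0$ if no site is destroyed. If signal $s$ is observed, the expected damage from placing the bomb in site 1 is $d_1(s|x)=c\,P(T_1=0\mid s)$, and from placing it in site 2 it is $d_2(s|x)=P(T_2=0\mid s)$. The attacker responds optimally by choosing a site with the larger of these two quantities, so the expected damage under the attacker's optimal response is $$d(x)=\sum_{s\in\{0,1\}^2}P(s)\max\{d_1(s|x),d_2(s|x)\}=\sum_{s\in\{0,1\}^2}\max\{c\,P(T_1=0,\,S=s),\;P(T_2=0,\,S=s)\},$$ where $S=(S_1,S_2)$ and all probabilities are computed with the prior given by $x$. The defender chooses $x$ to minimize $d(x)$. *)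

theory Defs
  imports "HOL-Probability.Probability"
begin

datatype site = Site1 | Site2

(* A signal (s1, s2) in {0,1}^2 is a pair of Booleans, True standing for 1. *)
type_synonym signal = "bool \<times> bool"

definition lock_pmf :: "real \<Rightarrow> site pmf" where
  "lock_pmf x = map_pmf (\<lambda>h. if h then Site2 else Site1) (bernoulli_pmf x)"

(* Result of testing a single site; t tells whether that site has the lock.
   a is the sensitivity P(S = 1 | T = 1), b the specificity P(S = 0 | T = 0). *)
definition test_pmf :: "real \<Rightarrow> real \<Rightarrow> bool \<Rightarrow> bool pmf" where
  "test_pmf a b t = bernoulli_pmf (if t then a else 1 - b)"

(* Joint law of the lock position and the signal; the two tests are drawn
   independently given the position. *)
definition game_pmf :: "real \<Rightarrow> real \<Rightarrow> real \<Rightarrow> (site \<times> signal) pmf" where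
  "game_pmf a b x =
     do {
       l \<leftarrow> lock_pmf x;
       s1 \<leftarrow> test_pmf a b (l = Site1);
       s2 \<leftarrow> test_pmf a b (l = Site2);
       return_pmf (l, (s1, s2))
     }"

fun site_value :: "real \<Rightarrow> site \<Rightarrow> real" where
  "site_value c Site1 = c"
| "site_value c Site2 = 1"

definition signal_prob :: "real \<Rightarrow> real \<Rightarrow> real \<Rightarrow> signal \<Rightarrow> real" where
  "signal_prob a b x s = measure_pmf.prob (game_pmf a b x) {w. snd w = s}"

(* d_i(s|x) = (value of site i) * P(T_i = 0 | S = s) *)
definition bomb_damage :: "real \<Rightarrow> real \<Rightarrow> real \<Rightarrow> real \<Rightarrow> site \<Rightarrow> signal \<Rightarrow> real" where
  "bomb_damage a b c x i s =
     site_value c i *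
     cond_prob (measure_pmf (game_pmf a b x)) (\<lambda>w. fst w \<noteq> i) (\<lambda>w. snd w = s)"

definition expected_damage :: "real \<Rightarrow> real \<Rightarrow> real \<Rightarrow> real \<Rightarrow> real" where
  "expected_damage a b c x =
     (\<Sum>s\<in>UNIV. signal_prob a b x s *
        max (bomb_damage a b c x Site1 s) (bomb_damage a b c x Site2 s))"

definition optimal_strategy :: "real \<Rightarrow> real \<Rightarrow> real \<Rightarrow> real \<Rightarrow> bool" where
  "optimal_strategy a b c x \<longleftrightarrow> is_arg_min (expected_damage a b c) (\<lambda>y. y \<in> {0..1}) x"

definition game_value :: "real \<Rightarrow> real \<Rightarrow> real \<Rightarrow> real" where
  "game_value a b c = (INF x\<in>{0..1}. expected_damage a b c x)"

end

theory Submission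
  imports Defs
begin

text \<open>
  In terms of joint probabilities, the signals fall into three kinds.  Both \<open>(1,1)\<close> and \<open>(0,0)\<close> are
  uninformative: each has the same likelihood under either lock position, and their total
  likelihood is \<open>m = a(1-b) + b(1-a)\<close>.  The other two point to one site, correctly with
  probability \<open>e1 = ab\<close> and wrongly with probability \<open>e2 = (1-a)(1-b)\<close>.  Hence \<open>d\<close> is a sum of three maxima of
  linear functions of \<open>x\<close>, in the order \<open>(0,1)\<close>, \<open>(1,0)\<close>, uninformative:
  \<open>d(x) = max(c x e1, (1-x) e2) + max(c x e2, (1-x) e1) + m max(c x, 1-x)\<close>, where \<open>e1 + e2 + m = 1\<close>.

  The minimum is certified by linear programming duality.  A mixed strategy of the attacker
  replaces each maximum by a convex combination of its two arguments, which can only lower the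
  damage; if the weights make the total independent of \<open>x\<close>, that constant bounds \<open>d\<close> from below
  everywhere.  If \<open>c \<le> c_star\<close>, an equalizing strategy bombs the site that looks unlocked after a
  signal pointing to one site, and mixes after an uninformative one (\<open>damage_lower_bound_small_c\<close>), and the bound is met at \<open>\<rho>3\<close>, where
  the attacker is indifferent after such a signal.  If \<open>c \<ge> c_star\<close>, site 1 is so valuable
  that the defender keeps the lock mostly there; the attacker bombs site 2 after every signal but
  the one pointing to site 2, and mixes after that one (\<open>damage_lower_bound_large_c\<close>).  This bound
  is met at \<open>\<rho>1\<close>, the point of indifference after that signal.  At \<open>c = c_star\<close> no mixing is
  needed: the pure strategy common to both cases already gives constant damage, and it is a best
  response on the whole interval between the two points.
\<close>

section \<open>The expected damage as an explicit function\<close>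

lemma pmf_game:
  assumes "0 \<le> x" "x \<le> 1" "0 \<le> a" "a \<le> 1" "0 \<le> b" "b \<le> 1"
  shows "pmf (game_pmf a b x) (Site1, s1, s2) =
           (1 - x) * (if s1 then a else 1 - a) * (if s2 then 1 - b else b)"
    and "pmf (game_pmf a b x) (Site2, s1, s2) =
           x * (if s1 then 1 - b else b) * (if s2 then a else 1 - a)"
  using assms
  by (auto simp: game_pmf_def lock_pmf_def test_pmf_def bind_map_pmf pmf_bind
      indicator_def algebra_simps)

text \<open>Multiplying by the probability of the signal undoes the conditioning.  This remains true for a
  signal of probability zero, where the conditional probability has the default value zero.\<close>

lemma signal_prob_times_bomb_damage:
  "signal_prob a b x s * bomb_damage a b c x i s =
     site_value c i * pmf (game_pmf a b x) (case i of Site1 \<Rightarrow> Site2 | Site2 \<Rightarrow> Site1, s)"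
proof -
  let ?M = "measure_pmf (game_pmf a b x)"
  let ?j = "case i of Site1 \<Rightarrow> Site2 | Site2 \<Rightarrow> Site1"
  have eq: "{w. fst w \<noteq> i \<and> snd w = s} = {(?j, s)}"
  proof -
    have "l \<noteq> i \<longleftrightarrow> l = ?j" for l by (cases l; cases i) auto
    then have "{w. fst w \<noteq> i \<and> snd w = s} = {w. fst w = ?j \<and> snd w = s}"
      by (simp only:)
    then show ?thesis by (simp add: prod_eq_iff set_eq_iff)
  qed
  have "measure ?M {w. fst w \<noteq> i \<and> snd w = s} \<le> measure ?M {w. snd w = s}"
    by (rule measure_pmf.finite_measure_mono) auto
  then have "measure ?M {w. snd w = s} = 0 \<Longrightarrow> pmf (game_pmf a b x) (?j, s) = 0"
    unfolding eq by (simp add: measure_pmf_single)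
  then show ?thesis
    by (auto simp: signal_prob_def bomb_damage_def cond_prob_def eq measure_pmf_single)
qed

lemma expected_damage_joint:
  "expected_damage a b c x =
     (\<Sum>s\<in>UNIV. max (c * pmf (game_pmf a b x) (Site2, s)) (pmf (game_pmf a b x) (Site1, s)))"
  unfolding expected_damage_def
proof (rule sum.cong[OF refl])
  fix s
  have "signal_prob a b x s \<ge> 0" by (simp add: signal_prob_def)
  then have "signal_prob a b x s * max (bomb_damage a b c x Site1 s) (bomb_damage a b c x Site2 s) =
      max (signal_prob a b x s * bomb_damage a b c x Site1 s)
          (signal_prob a b x s * bomb_damage a b c x Site2 s)"
    by (simp add: max_mult_distrib_left)
  then show "signal_prob a b x s * max (bomb_damage a b c x Site1 s) (bomb_damage a b c x Site2 s) =
      max (c * pmf (game_pmf a b x) (Site2, s)) (pmf (game_pmf a b x) (Site1, s))"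
    by (simp add: signal_prob_times_bomb_damage)
qed

definition damage :: "real \<Rightarrow> real \<Rightarrow> real \<Rightarrow> real \<Rightarrow> real \<Rightarrow> real" where
  "damage e1 e2 m c x =
     max (c * x * e1) ((1 - x) * e2) + max (c * x * e2) ((1 - x) * e1) + m * max (c * x) (1 - x)"

lemma expected_damage_eq_damage:
  assumes "0 \<le> x" "x \<le> 1" "0 \<le> a" "a \<le> 1" "0 \<le> b" "b \<le> 1"
  shows "expected_damage a b c x =
           damage (a * b) ((1 - a) * (1 - b)) (a * (1 - b) + b * (1 - a)) c x"
proof -
  have scale: "max (c * x * p) ((1 - x) * p) = p * max (c * x) (1 - x)" if "0 \<le> p" for p :: real
    using that by (simp add: max_mult_distrib_left mult.commute)
  have ff: "max (c * x * (b * (1 - a))) ((1 - x) * (b * (1 - a))) = b * (1 - a) * max (c * x) (1 - x)"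
    and tt: "max (c * x * (a * (1 - b))) ((1 - x) * (a * (1 - b))) = a * (1 - b) * max (c * x) (1 - x)"
    using assms by (auto intro!: scale)
  show ?thesis
    unfolding expected_damage_joint damage_def UNIV_Times_UNIV[symmetric] sum.cartesian_product[symmetric]
      UNIV_bool distrib_right[of "a * (1 - b)"] ff[symmetric] tt[symmetric]
    using assms by (simp add: pmf_game mult_ac)
qed

section \<open>Lower bounds from mixed strategies of the attacker\<close>

lemma max_ge_convex_combination:
  fixes p q t :: real
  assumes "0 \<le> t" "t \<le> 1"
  shows "t * p + (1 - t) * q \<le> max p q"
  using convex_bound_le[of p "max p q" q t "1 - t"] assms by simp

text \<open>The upper bound on \<open>c\<close> is exactly what makes the equalizing weight \<open>t\<close> nonnegative; its being at
  most one follows from \<open>c \<ge> 1\<close>.\<close>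

lemma damage_lower_bound_small_c:
  assumes "0 < e1" "0 < m" "1 \<le> c" "c * e1 \<le> e1 + m"
  shows "c * (2 * e1 + m) / (1 + c) \<le> damage e1 e2 m c x"
proof -
  define t where "t = (m + e1 - c * e1) / (m * (1 + c))"
  have t0: "0 \<le> t" using assms by (simp add: t_def)
  have "e1 \<le> c * e1" "0 \<le> m * c" using assms by simp_all
  then have "m + e1 - c * e1 \<le> 1 * (m * (1 + c))" unfolding distrib_left mult_1 by linarith
  moreover have "0 < m * (1 + c)" using assms by simp
  ultimately have t1: "t \<le> 1" unfolding t_def by (simp only: pos_divide_le_eq)
  have tm: "m * t = (m + e1 - c * e1) / (1 + c)" using assms by (simp add: t_def)
  have "c * (2 * e1 + m) / (1 + c) = c * x * e1 + (1 - x) * e1 + (m * t * (c * x) + (m - m * t) * (1 - x))"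
    unfolding tm using assms by (simp add: divide_simps) (simp add: algebra_simps)
  also have "\<dots> = c * x * e1 + (1 - x) * e1 + m * (t * (c * x) + (1 - t) * (1 - x))"
    by (simp add: algebra_simps)
  also have "\<dots> \<le> damage e1 e2 m c x"
    unfolding damage_def
    using max_ge_convex_combination[OF t0 t1, of "c * x" "1 - x"] assms
    by (intro add_mono mult_left_mono) auto
  finally show ?thesis .
qed

lemma damage_at_rho3:
  assumes "0 < e2" "e2 \<le> e1" "1 \<le> c"
  shows "damage e1 e2 m c (1 / (1 + c)) = c * (2 * e1 + m) / (1 + c)"
proof -
  have x: "1 - 1 / (1 + c) = c / (1 + c)" using assms by (simp add: field_simps)
  have "c / (1 + c) * e2 \<le> c / (1 + c) * e1" using assms by (intro mult_left_mono) auto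
  then show ?thesis unfolding damage_def x
    by (simp add: max_def add_divide_distrib algebra_simps)
qed

text \<open>Here the lower bound on \<open>c\<close> is what keeps the equalizing weight \<open>t\<close> at most one.\<close>

lemma damage_lower_bound_large_c:
  assumes "0 < e1" "0 < e2" "0 \<le> m" "e1 + e2 + m = 1" "e1 + m \<le> c * e1"
  shows "c * e1 / (c * e1 + e2) \<le> damage e1 e2 m c x"
proof -
  define t where "t = 1 / (c * e1 + e2)"
  have pos: "1 \<le> c * e1 + e2" using assms by simp
  then have t0: "0 \<le> t" and t1: "t \<le> 1" by (auto simp: t_def)
  have t: "t * (c * e1 + e2) = 1" using pos by (simp add: t_def)
  have m: "m = 1 - e1 - e2" using assms by simp
  have "c * e1 / (c * e1 + e2) = t * (c * e1)" by (simp add: t_def)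
  also have "\<dots> = 1 - t * e2" using t by (simp add: algebra_simps)
  also have "\<dots> = x * (t * (c * e1 + e2)) + (1 - x) - t * e2" by (simp add: t)
  also have "\<dots> = (t * (c * x * e1) + (1 - t) * ((1 - x) * e2)) + (1 - x) * e1 + m * (1 - x)"
    unfolding m by (simp add: algebra_simps)
  also have "\<dots> \<le> damage e1 e2 m c x"
    unfolding damage_def
    using max_ge_convex_combination[OF t0 t1] assms by (intro add_mono mult_left_mono) auto
  finally show ?thesis .
qed

text \<open>If site 2 is the better target after an uninformative signal, it is all the more so after the
  signal that points to site 1, because \<open>e2 \<le> e1\<close>.  So between the two points of indifference only
  the signal that points to site 2 makes the attacker bomb site 1.\<close>

lemma damage_between:
  assumes "0 < e2" "e2 \<le> e1" "0 \<le> c" "0 \<le> x" "c * x \<le> 1 - x" "(1 - x) * e2 \<le> c * x * e1"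
  shows "damage e1 e2 m c x = c * x * e1 + (1 - x) * (e1 + m)"
proof -
  have "0 \<le> c * x" using assms by simp
  then have "c * x * e2 \<le> (1 - x) * e1" using assms by (intro mult_mono) linarith+
  then show ?thesis using assms by (simp add: damage_def max_def algebra_simps)
qed

lemma damage_at_rho1:
  assumes "0 < e2" "e2 \<le> e1" "e1 + e2 + m = 1" "1 \<le> c"
  shows "damage e1 e2 m c (1 / (1 + c * (e1 / e2))) = c * e1 / (c * e1 + e2)"
proof -
  let ?x = "1 / (1 + c * (e1 / e2))"
  have e: "0 < c * e1" using assms by simp
  have x: "?x = e2 / (c * e1 + e2)"
    using assms by (simp add: field_simps)
  have x': "1 - ?x = c * e1 / (c * e1 + e2)"
    unfolding x using add_pos_pos[OF e assms(1)] by (simp add: diff_eq_eq flip: add_divide_distrib)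
  have "damage e1 e2 m c ?x = c * ?x * e1 + (1 - ?x) * (e1 + m)"
  proof (rule damage_between)
    show "c * ?x \<le> 1 - ?x" unfolding x' unfolding x using assms e
      by (simp add: divide_right_mono)
    show "(1 - ?x) * e2 \<le> c * ?x * e1" unfolding x' unfolding x by (simp add: mult_ac)
  qed (use assms e x in auto)
  also have "\<dots> = (c * e1 / (c * e1 + e2)) * (e2 + (e1 + m))"
    unfolding x' unfolding x by (simp add: algebra_simps add_divide_distrib)
  also have "e2 + (e1 + m) = 1" using assms by simp
  finally show ?thesis by simp
qed

section \<open>Value and optimal strategies\<close>

lemma optimal_strategyI:
  assumes "x \<in> {0..1}" "\<And>y. y \<in> {0..1} \<Longrightarrow> expected_damage a b c x \<le> expected_damage a b c y"
  shows "optimal_strategy a b c x" "game_value a b c = expected_damage a b c x"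
proof -
  show "optimal_strategy a b c x"
    unfolding optimal_strategy_def is_arg_min_linorder using assms by blast
  show "game_value a b c = expected_damage a b c x"
    unfolding game_value_def by (rule cInf_eq_minimum) (use assms in auto)
qed

theorem mainTheorem2:
  fixes a b c e1 e2 \<kappa> c_star \<rho>1 \<rho>3 :: real
  assumes a: "1 / 2 < a" "a < 1"
    and b: "1 / 2 < b" "b < 1"
    and c: "1 \<le> c"
    and e1: "e1 = a * b"
    and e2: "e2 = (1 - a) * (1 - b)"
    and kappa: "\<kappa> = e1 / e2"
    and c_star: "c_star = (a + b) / (a * b) - 1"
    and rho1: "\<rho>1 = 1 / (1 + c * \<kappa>)"
    and rho3: "\<rho>3 = 1 / (1 + c)"
  shows "c_star > 1 \<and>
    (c \<le> c_star \<longrightarrow>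
      optimal_strategy a b c \<rho>3 \<and>
      game_value a b c = expected_damage a b c \<rho>3 \<and>
      expected_damage a b c \<rho>3 = c * (a + b) / (1 + c)) \<and>
    (c \<ge> c_star \<longrightarrow>
      optimal_strategy a b c \<rho>1 \<and>
      game_value a b c = expected_damage a b c \<rho>1 \<and>
      expected_damage a b c \<rho>1 = c / (1 / \<kappa> + c)) \<and>
    (c = c_star \<longrightarrow>
      (\<forall>x\<in>{\<rho>1<..<\<rho>3}. optimal_strategy a b c x) \<and>
      game_value a b c = expected_damage a b c \<rho>1 \<and>
      expected_damage a b c \<rho>1 = expected_damage a b c \<rho>3 \<and>
      expected_damage a b c \<rho>3 = a + b - a * b)"
proof -
  define m where "m = a * (1 - b) + b * (1 - a)"
  define d where "d = expected_damage a b c"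
  have pos: "0 < e1" "0 < e2" "0 < m" using a b by (auto simp: e1 e2 m_def intro!: add_pos_pos)
  have le: "e2 \<le> e1" unfolding e1 e2 using a b by (intro mult_mono) auto
  have sum1: "e1 + e2 + m = 1" by (simp add: e1 e2 m_def algebra_simps)
  have em: "e1 + m = a + b - a * b" "2 * e1 + m = a + b" by (simp_all add: e1 m_def algebra_simps)
  have "c_star * e1 = a + b - e1" using pos(1) by (simp add: c_star left_diff_distrib flip: e1)
  then have star: "c_star * e1 = e1 + m" by (simp add: em(1)) (simp add: e1)
  have less_star: "z < c_star \<longleftrightarrow> z * e1 < e1 + m" for z
    using pos(1) by (simp flip: star)
  have "c_star > 1" using pos by (simp add: less_star)
  have d_eq: "d x = damage e1 e2 m c x" if "x \<in> {0..1}" for x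
    unfolding d_def e1 e2 m_def using that a b by (intro expected_damage_eq_damage) auto
  have k0: "0 < \<kappa>" using pos by (simp add: kappa)
  have r3: "\<rho>3 \<in> {0..1}" using c by (simp add: rho3)
  have r1: "\<rho>1 \<in> {0..1}" using c mult_pos_pos[of c, OF _ k0] by (simp add: rho1)
  have d3: "d \<rho>3 = c * (a + b) / (1 + c)"
    using damage_at_rho3[OF pos(2) le c] unfolding d_eq[OF r3] by (simp add: rho3 em)
  have d1: "d \<rho>1 = c * e1 / (c * e1 + e2)"
    using damage_at_rho1[OF pos(2) le sum1 c] unfolding d_eq[OF r1] by (simp add: rho1 kappa)
  have d1': "c * e1 / (c * e1 + e2) = c / (1 / \<kappa> + c)"
  proof -
    have "c * e1 + e2 = e1 * (1 / \<kappa> + c)" using pos by (simp add: kappa field_simps)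
    then show ?thesis using pos by simp
  qed
  have small: "d \<rho>3 \<le> d y" if "c \<le> c_star" "y \<in> {0..1}" for y
  proof -
    have "c * e1 \<le> e1 + m" using that less_star[of c] pos(1) by (simp flip: star)
    then show ?thesis
      using damage_lower_bound_small_c[OF pos(1,3) c] unfolding d3 d_eq[OF that(2)] em by simp
  qed
  have large: "d \<rho>1 \<le> d y" if "c_star \<le> c" "y \<in> {0..1}" for y
  proof -
    have "e1 + m \<le> c * e1" using that pos(1) by (simp flip: star)
    then show ?thesis
      using damage_lower_bound_large_c[OF pos(1,2) _ sum1] pos(3) unfolding d1 d_eq[OF that(2)] by simp
  qed
  have crit1: "d \<rho>1 = a + b - a * b" if "c = c_star"
  proof -
    have "c * e1 + e2 = 1" "c * e1 = a + b - a * b" using star sum1 em(1) that by simp_all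
    then show ?thesis unfolding d1 by simp
  qed
  have between: "d x = a + b - a * b" if "c = c_star" "x \<in> {\<rho>1<..<\<rho>3}" for x
  proof -
    have x: "x \<in> {0..1}" using that r1 r3 by auto
    have x3: "c * x \<le> 1 - x" using that(2) c by (simp add: rho3 field_simps)
    have "1 < x * (1 + c * \<kappa>)"
      using that(2) c k0 by (simp add: rho1 divide_less_eq add_pos_pos)
    then have "(1 - x) * e2 \<le> x * c * \<kappa> * e2" using pos by (intro mult_right_mono) (auto simp: algebra_simps)
    then have x1: "(1 - x) * e2 \<le> c * x * e1" using pos by (simp add: kappa mult_ac)
    have "d x = c * x * e1 + (1 - x) * (e1 + m)"
      using damage_between[OF pos(2) le _ _ x3 x1] x c by (simp add: d_eq)
    also have "\<dots> = x * (c_star * e1) + (1 - x) * (e1 + m)" by (simp add: that)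
    also have "\<dots> = e1 + m" unfolding star by (simp add: algebra_simps)
    finally show ?thesis by (simp add: em)
  qed
  have opt: "optimal_strategy a b c x \<and> game_value a b c = d x"
    if "x \<in> {0..1}" "\<And>y. y \<in> {0..1} \<Longrightarrow> d x \<le> d y" for x
    using optimal_strategyI[of x a b c] that unfolding d_def by blast
  have i: "optimal_strategy a b c \<rho>3 \<and> game_value a b c = d \<rho>3" if "c \<le> c_star"
    using opt[OF r3] small that by blast
  have ii: "optimal_strategy a b c \<rho>1 \<and> game_value a b c = d \<rho>1" if "c_star \<le> c"
    using opt[OF r1] large that by blast
  have iii: "optimal_strategy a b c x" if xs: "c = c_star" "x \<in> {\<rho>1<..<\<rho>3}" for x
  proof -
    have "x \<in> {0..1}" using xs(2) r1 r3 by auto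
    moreover have "d x \<le> d y" if "y \<in> {0..1}" for y
      using large[OF _ that] between[OF xs] crit1 \<open>c = c_star\<close> by simp
    ultimately show ?thesis using opt by blast
  qed
  have crit: "d \<rho>1 = d \<rho>3" if "c = c_star" using i ii that by simp
  show ?thesis
    using \<open>c_star > 1\<close> i ii iii crit crit1 d3 d1 d1' unfolding d_def by (intro conjI impI ballI) auto
qed

end
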